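(* For $v\in\mathbb{C}^g$, $$H(v)=\chi\,\varepsilon\exp\Bigl(\tfrac12\,{}^tv\,\kappa'(\mu')^{-1}v\Bigr)\,\theta\begin{bmatrix}\delta'\\\delta''\end{bmatrix}\bigl((2\mu')^{-1}v,\tau\bigr).$$
   Context: **The curve $V$.** Let $g\ge1$, and let $N(x)=\nu_0x^{2g+2}+\nu_2x^{2g+1}+\cdots+\nu_{4g+2}x+\nu_{4g+4}$ with $\nu_i\in\mathbb{C}$, $\nu_0\ne0$, have no multiple roots. Let $V$ be the (compactified) nonsingular hyperelliptic curve $y^2=N(x)$ of genus $g$ (two points at infinity), with holomorphic 1-forms $\mu_i=\frac{x^{i-1}}{2y}dx$ ($1\le i\le g$), $\mu={}^t(\mu_1,\dots,\mu_g)$. Let $\{\mathfrak{a}_i,\mathfrak{b}_i\}_{i=1}^g$ be a canonical homology basis of $V$, $2\mu'=(\int_{\mathfrak{a}_j}\mu_i)$, $2\mu''=(\int_{\mathfrak{b}_j}\mu_i)$. Fix $a\in\mathbb{C}$ with $N(a)=0$, and write $N(x)=\nu_0(x-a)\prod_{i=1}^{2g+1}(x-a_i)$. Let $v={}^t(v_{2g},v_{2g-2},\dots,v_2)\in\mathbb{C}^g$. **The curve $\widetilde C$ and the matrix $D$.** Fix $\mathfrak{s},\mathfrak{t}\in\mathbb{C}$ with $\mathfrak{s}\mathfrak{t}\ne0$ and $\mathfrak{s}^{2g+1}/\mathfrak{t}^2=N'(a)$. Let $\widetilde{M}(X)=\prod_{i=1}^{2g+1}\bigl(X-\frac{\mathfrak{s}}{a_i-a}\bigr)=\widetilde\lambda_0X^{2g+1}+\widetilde\lambda_2X^{2g}+\cdots+\widetilde\lambda_{4g+2}$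 and let $\widetilde{C}$ be the hyperelliptic curve $Y^2=\widetilde M(X)$. The map $\zeta:V\to\widetilde C$, $(x,y)\mapsto\bigl(\frac{\mathfrak{s}}{x-a},\frac{\mathfrak{t}y}{(x-a)^{g+1}}\bigr)$ is an isomorphism. On $\widetilde C$ let $\omega_i=-\frac{X^{g-i}}{2Y}dX$ ($1\le i\le g$), and let $D$ be the invertible $g\times g$ matrix with ${}^t(\zeta^*\omega_1,\dots,\zeta^*\omega_g)=D\mu$. **The sigma function of $\widetilde C$.** Let $\eta_i=-\frac{1}{2Y}\sum_{k=g-i+1}^{g+i-1}(k+i-g)\widetilde\lambda_{2g+2i-2k-2}X^kdX$ ($1\le i\le g$). With respect to the canonical homology basis $A_i=\zeta(\mathfrak{a}_i)$, $B_i=\zeta(\mathfrak{b}_i)$ of $\widetilde C$ put $2\omega'=(\int_{A_j}\omega_i)$, $2\omega''=(\int_{B_j}\omega_i)$, $-2\eta'=(\int_{A_j}\eta_i)$, $-2\eta''=(\int_{B_j}\eta_i)$, $\tau=(\omega')^{-1}\omega''$. Let $\tau\delta'+\delta''$ ($\delta',\delta''\in\mathbb{R}^g$) be the Riemann constant of $\widetilde C$ with respect to this basis and the base point $\infty$ (it coincides with the Riemann constant of $V$ with respect to $\{\mathfrak{a}_i,\mathfrak{b}_i\}$ and the base point $(a,0)$). For $u={}^t(u_1,u_3,\dots,u_{2g-1})\in\mathbb{C}^g$, $$\sigma(u)=\varepsilon\exp\bigl(\tfrac12{}^tu\,\eta'(\omega')^{-1}u\bigr)\,\theta\begin{bmatrix}\delta'\\\delta''\end{bmatrix}\bigl((2\omega')^{-1}u,\tau\bigr),$$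 $$\theta\begin{bmatrix}\delta'\\\delta''\end{bmatrix}(u,\tau)=\sum_{n\in\mathbb{Z}^g}\exp\{\pi\sqrt{-1}\,{}^t(n+\delta')\tau(n+\delta')+2\pi\sqrt{-1}\,{}^t(n+\delta')(u+\delta'')\}.$$ The nonzero constant $\varepsilon$ is the unique one for which the Taylor expansion of $\sigma$ at $0$ is $S(u)$ plus terms $\gamma_{n_1,\dots,n_g}u_1^{n_1}u_3^{n_2}\cdots u_{2g-1}^{n_g}$ with $\sum_{i=1}^g(2i-1)n_i>g(g+1)/2$; here $S(u)=\det(p_{g+j+1-2i}(T))_{1\le i,j\le g}|_{T_i=u_i}$ (it involves only $T_1,T_3,\dots,T_{2g-1}$), $\exp(\sum_{j\ge1}T_jk^j)=\sum_{n\ge0}p_n(T)k^n$, $p_n=0$ for $n<0$. **The matrix $\Omega$.** Let $f(e_1,e_2)=\sum_{i=0}^{g+1}e_1^ie_2^i\{2\nu_{4g+4-4i}+\nu_{4g+2-4i}(e_1+e_2)\}$ (with $\nu_{-2}=0$), $\widetilde f(e_1,e_2)=\sum_{i=0}^ge_1^ie_2^i\{2\widetilde\lambda_{4g+2-4i}+\widetilde\lambda_{4g-4i}(e_1+e_2)\}$ and $\overline f(e_1,e_2)=\mathfrak{t}^{-2}(e_1-a)^{g+1}(e_2-a)^{g+1}\widetilde f\bigl(\frac{\mathfrak{s}}{e_1-a},\frac{\mathfrak{s}}{e_2-a}\bigr)$. The $\mathfrak{n}_{i,j}=\mathfrak{n}_{j,i}\in\mathbb{C}$ ($1\le i,j\le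 g$) are the complex numbers determined by $\overline f(e_1,e_2)=f(e_1,e_2)+(e_1-e_2)^2\sum_{i,j=1}^g\mathfrak{n}_{i,j}e_1^{i-1}e_2^{j-1}$, and $\Omega=(\mathfrak{n}_{i,j})_{1\le i,j\le g}$. **The function $H$.** Let $\chi=\mathfrak{s}^{(g^2-3g-2)/4}\mathfrak{t}$ if $g(g+1)/2$ is odd and $\chi=\mathfrak{s}^{g(g+1)/4}$ if $g(g+1)/2$ is even. $H$ is the entire function on $\mathbb{C}^g$ given by $H(v)=\chi\exp({}^tv\,\Omega\,v)\,\sigma(Dv)$. **The second-kind periods $\kappa',\kappa''$.** Define meromorphic 1-forms of the second kind on $V$ by ${}^t(\kappa_1,\dots,\kappa_g)={}^t\{(\zeta^*(\eta_1),\dots,\zeta^*(\eta_g))D\}-2\Omega\mu$, and $-2\kappa'=(\int_{\mathfrak{a}_j}\kappa_i)$, $-2\kappa''=(\int_{\mathfrak{b}_j}\kappa_i)$. *)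

theory Defs
  imports
    "HOL-Analysis.Analysis"
    "HOL-Homology.Homology"
    "HOL-Computational_Algebra.Formal_Power_Series"
    "Jordan_Normal_Form.Gauss_Jordan_Elimination"
    "Jordan_Normal_Form.Determinant"
begin

hide_type (open) Finite_Cartesian_Product.vec
hide_const (open) Finite_Cartesian_Product.vec Finite_Cartesian_Product.mat
  Determinants.det Finite_Cartesian_Product.row Finite_Cartesian_Product.column
unbundle no vec_syntax
unbundle no inner_syntax


section \<open>Matrices and theta functions\<close>

text \<open>The inverse of a square matrix, totalised by the zero matrix (compare \<open>inverse 0 = 0\<close>).\<close>

definition minv :: "complex mat \<Rightarrow> complex mat" where
  "minv A = (case mat_inverse A of Some B \<Rightarrow> B | None \<Rightarrow> 0\<^sub>m (dim_row A) (dim_col A))"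

abbreviation cvec_of_int :: "int vec \<Rightarrow> complex vec" where
  "cvec_of_int \<equiv> map_vec of_int"

abbreviation cvec_of_real :: "real vec \<Rightarrow> complex vec" where
  "cvec_of_real \<equiv> map_vec of_real"

definition theta_char :: "nat \<Rightarrow> real vec \<Rightarrow> real vec \<Rightarrow> complex vec \<Rightarrow> complex mat \<Rightarrow> complex" where
  "theta_char g \<delta>' \<delta>'' u \<tau> =
     (\<Sum>\<^sub>\<infinity>n\<in>carrier_vec g.
        (let m = cvec_of_int n + cvec_of_real \<delta>' in
         exp (of_real pi * \<i> * (m \<bullet> (\<tau> *\<^sub>v m))
              + 2 * of_real pi * \<i> * (m \<bullet> (u + cvec_of_real \<delta>'')))))"


section \<open>Affine hyperelliptic curves, forms and integrals\<close>

definition affine_curve :: "complex poly \<Rightarrow> (complex \<times> complex) set" where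
  "affine_curve P = {(x, y). y ^ 2 = poly P x}"

text \<open>
  A function \<open>h\<close> on the points of the affine curve stands for the 1-form \<open>h(x, y) dx\<close>.
  Away from the branch points (\<open>y = 0\<close>) and from infinity, \<open>x\<close> is a local coordinate.
\<close>

type_synonym form = "complex \<times> complex \<Rightarrow> complex"

definition form_integral :: "form \<Rightarrow> (real \<Rightarrow> complex \<times> complex) \<Rightarrow> complex" where
  "form_integral h \<gamma> =
     integral {0..1} (\<lambda>t. h (\<gamma> t) * vector_derivative (\<lambda>t. fst (\<gamma> t)) (at t within {0..1}))"

text \<open>Half of the period matrix; the cycles and forms are indexed by \<open>1, \<dots>, g\<close>.\<close>

definition half_periods ::
    "nat \<Rightarrow> (nat \<Rightarrow> form) \<Rightarrow> (nat \<Rightarrow> real \<Rightarrow> complex \<times> complex) \<Rightarrow> complex mat" where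
  "half_periods g h c = mat g g (\<lambda>(i, j). form_integral (h (Suc i)) (c (Suc j)) / 2)"

definition mu :: "nat \<Rightarrow> form" where
  "mu i = (\<lambda>(x, y). x ^ (i - 1) / (2 * y))"

definition omega :: "nat \<Rightarrow> nat \<Rightarrow> form" where
  "omega g i = (\<lambda>(X, Y). - (X ^ (g - i) / (2 * Y)))"

definition eta :: "nat \<Rightarrow> (nat \<Rightarrow> complex) \<Rightarrow> nat \<Rightarrow> form" where
  "eta g l i = (\<lambda>(X, Y). - (1 / (2 * Y)) *
     (\<Sum>k = g - i + 1..g + i - 1. of_nat (k + i - g) * l (2 * g + 2 * i - 2 * k - 2) * X ^ k))"


section \<open>The compactified curve and its homology\<close>

text \<open>
  For \<open>N\<close> of degree \<open>2g + 2\<close> the nonsingular compactification of \<open>y\<^sup>2 = N(x)\<close> is glued from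
  the affine curve and the affine curve \<open>w\<^sup>2 = s\<^bsup>2g+2\<^esup> N(1/s)\<close> along
  \<open>s = 1/x, w = y/x\<^bsup>g+1\<^esup>\<close>. Points of the first chart are \<open>Inl (x, y)\<close>; the remaining points
  \<open>s = 0\<close> of the second chart, i.e. the points at infinity, are \<open>Inr w\<close>.
\<close>

type_synonym cpoint = "complex \<times> complex + complex"

definition chart_infinity :: "nat \<Rightarrow> complex \<times> complex \<Rightarrow> cpoint" where
  "chart_infinity g = (\<lambda>(s, w). if s = 0 then Inr w else Inl (1 / s, w / s ^ (g + 1)))"

definition openin_curve :: "nat \<Rightarrow> complex poly \<Rightarrow> cpoint set \<Rightarrow> bool" where
  "openin_curve g N U \<longleftrightarrow>
     U \<subseteq> Inl ` affine_curve N \<union> Inr ` {w. w ^ 2 = lead_coeff N} \<and>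
     openin (top_of_set (affine_curve N)) {p \<in> affine_curve N. Inl p \<in> U} \<and>
     openin (top_of_set (affine_curve (reflect_poly N)))
       {q \<in> affine_curve (reflect_poly N). chart_infinity g q \<in> U}"

definition compact_curve :: "nat \<Rightarrow> complex poly \<Rightarrow> cpoint topology" where
  "compact_curve g N = topology (openin_curve g N)"

lemma istopology_openin_curve: "istopology (openin_curve g N)"
  unfolding istopology_def
proof (intro conjI allI impI)
  fix S T assume "openin_curve g N S" "openin_curve g N T"
  moreover have "{p \<in> A. h p \<in> S \<inter> T} = {p \<in> A. h p \<in> S} \<inter> {p \<in> A. h p \<in> T}"
    for A :: "(complex \<times> complex) set" and h :: "complex \<times> complex \<Rightarrow> cpoint" by auto
  ultimately show "openin_curve g N (S \<inter> T)"
    unfolding openin_curve_def by (auto simp del: Int_iff)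
next
  fix K assume K: "\<forall>S\<in>K. openin_curve g N S"
  have eq: "{p \<in> A. h p \<in> \<Union>K} = (\<Union>S\<in>K. {p \<in> A. h p \<in> S})"
    for A :: "(complex \<times> complex) set" and h :: "complex \<times> complex \<Rightarrow> cpoint" by auto
  show "openin_curve g N (\<Union>K)"
    unfolding openin_curve_def eq
    using K unfolding openin_curve_def by (intro conjI openin_Union Union_least) auto
qed

lemma openin_compact_curve: "openin (compact_curve g N) U \<longleftrightarrow> openin_curve g N U"
  unfolding compact_curve_def by (simp add: istopology_openin_curve)

text \<open>
  Cycles are represented by closed paths in the finite part of the curve that avoid the branch
  points. Every class in the first homology group of the compactified curve contains such a path.
\<close>

definition regular_loop :: "complex poly \<Rightarrow> (real \<Rightarrow> complex \<times> complex) \<Rightarrow> bool" where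
  "regular_loop N \<gamma> \<longleftrightarrow> valid_path \<gamma> \<and> pathfinish \<gamma> = pathstart \<gamma> \<and>
     path_image \<gamma> \<subseteq> {(x, y) \<in> affine_curve N. y \<noteq> 0}"

definition loop_chain :: "(real \<Rightarrow> complex \<times> complex) \<Rightarrow> cpoint chain" where
  "loop_chain \<gamma> = frag_of (restrict (\<lambda>t. Inl (\<gamma> (t 1))) (standard_simplex 1))"

abbreviation homologous ::
    "nat \<Rightarrow> complex poly \<Rightarrow> cpoint chain \<Rightarrow> cpoint chain \<Rightarrow> bool" where
  "homologous g N \<equiv> homologous_rel 1 (compact_curve g N) {}"

definition crossings ::
    "(real \<Rightarrow> complex \<times> complex) \<Rightarrow> (real \<Rightarrow> complex \<times> complex) \<Rightarrow> (real \<times> real) set" where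
  "crossings \<gamma>1 \<gamma>2 = {(s, t). s \<in> {0..1} \<and> t \<in> {0..1} \<and> \<gamma>1 s = \<gamma>2 t}"

text \<open>
  The oriented area spanned by the two velocity vectors, in the local coordinate \<open>x\<close>: it is
  positive if the tangent of \<open>\<gamma>1\<close> followed by that of \<open>\<gamma>2\<close> is a positively oriented basis.
\<close>

definition crossing_area ::
    "(real \<Rightarrow> complex \<times> complex) \<Rightarrow> (real \<Rightarrow> complex \<times> complex) \<Rightarrow> real \<times> real \<Rightarrow> real" where
  "crossing_area \<gamma>1 \<gamma>2 = (\<lambda>(s, t).
     Im (cnj (vector_derivative (\<lambda>t. fst (\<gamma>1 t)) (at s)) * vector_derivative (\<lambda>t. fst (\<gamma>2 t)) (at t)))"

definition transversal ::
    "(real \<Rightarrow> complex \<times> complex) \<Rightarrow> (real \<Rightarrow> complex \<times> complex) \<Rightarrow> bool" where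
  "transversal \<gamma>1 \<gamma>2 \<longleftrightarrow> finite (crossings \<gamma>1 \<gamma>2) \<and>
     (\<forall>(s, t) \<in> crossings \<gamma>1 \<gamma>2. s \<in> {0<..<1} \<and> t \<in> {0<..<1} \<and>
        \<gamma>1 differentiable (at s) \<and> \<gamma>2 differentiable (at t) \<and> crossing_area \<gamma>1 \<gamma>2 (s, t) \<noteq> 0)"

text \<open>
  The intersection number of the homology classes of \<open>\<alpha>\<close> and \<open>\<beta>\<close> is \<open>k\<close>: the signed number of
  crossings of transversal representatives.
\<close>

definition has_intersection_number ::
    "nat \<Rightarrow> complex poly \<Rightarrow> (real \<Rightarrow> complex \<times> complex) \<Rightarrow> (real \<Rightarrow> complex \<times> complex) \<Rightarrow> int \<Rightarrow> bool"
where
  "has_intersection_number g N \<alpha> \<beta> k \<longleftrightarrow>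
     (\<exists>\<gamma>1 \<gamma>2. regular_loop N \<gamma>1 \<and> regular_loop N \<gamma>2 \<and>
        homologous g N (loop_chain \<gamma>1) (loop_chain \<alpha>) \<and>
        homologous g N (loop_chain \<gamma>2) (loop_chain \<beta>) \<and>
        transversal \<gamma>1 \<gamma>2 \<and>
        of_int k = (\<Sum>c\<in>crossings \<gamma>1 \<gamma>2. sgn (crossing_area \<gamma>1 \<gamma>2 c)))"

definition cycle_combination ::
    "nat \<Rightarrow> (nat \<Rightarrow> real \<Rightarrow> complex \<times> complex) \<Rightarrow> (nat \<Rightarrow> real \<Rightarrow> complex \<times> complex) \<Rightarrow>
     (nat \<Rightarrow> int) \<Rightarrow> (nat \<Rightarrow> int) \<Rightarrow> cpoint chain" where
  "cycle_combination g A B m n =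
     (\<Sum>i = 1..g. frag_cmul (m i) (loop_chain (A i)) + frag_cmul (n i) (loop_chain (B i)))"

definition canonical_homology_basis ::
    "nat \<Rightarrow> complex poly \<Rightarrow> (nat \<Rightarrow> real \<Rightarrow> complex \<times> complex) \<Rightarrow>
     (nat \<Rightarrow> real \<Rightarrow> complex \<times> complex) \<Rightarrow> bool" where
  "canonical_homology_basis g N A B \<longleftrightarrow>
     (\<forall>i\<in>{1..g}. regular_loop N (A i) \<and> regular_loop N (B i)) \<and>
     (\<forall>c. singular_relcycle 1 (compact_curve g N) {} c \<longrightarrow>
        (\<exists>m n. homologous g N c (cycle_combination g A B m n))) \<and>
     (\<forall>m n. homologous g N (cycle_combination g A B m n) 0 \<longrightarrow> (\<forall>i\<in>{1..g}. m i = 0 \<and> n i = 0)) \<and>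
     (\<forall>i\<in>{1..g}. \<forall>j\<in>{1..g}.
        has_intersection_number g N (A i) (A j) 0 \<and>
        has_intersection_number g N (B i) (B j) 0 \<and>
        has_intersection_number g N (A i) (B j) (if i = j then 1 else 0))"


section \<open>The Riemann constant\<close>

text \<open>
  Here \<open>M\<close> has odd degree, so that the curve has one point at infinity, the base point of the
  Abel map. The paths run from infinity (\<open>t = 0\<close>) to a point of the affine curve, and the integrals
  along them, improper at \<open>t = 0\<close>, are Henstock-Kurzweil integrals. The zero vector is a value of
  the Abel map at the base point itself.
\<close>

definition path_from_infinity :: "complex poly \<Rightarrow> (real \<Rightarrow> complex \<times> complex) \<Rightarrow> bool" where
  "path_from_infinity M \<gamma> \<longleftrightarrow> (\<forall>t\<in>{0<..1}. \<gamma> t \<in> affine_curve M) \<and>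
     (\<forall>c\<in>{0<..<1}. \<gamma> piecewise_C1_differentiable_on {c..1}) \<and>
     filterlim (\<lambda>t. fst (\<gamma> t)) at_infinity (at_right 0)"

definition abel_values :: "nat \<Rightarrow> complex poly \<Rightarrow> complex vec set" where
  "abel_values g M = insert (0\<^sub>v g)
     {w \<in> carrier_vec g. \<exists>\<gamma>. path_from_infinity M \<gamma> \<and>
        (\<forall>i<g. ((\<lambda>t. omega g (Suc i) (\<gamma> t) * vector_derivative (\<lambda>t. fst (\<gamma> t)) (at t within {0..1}))
                 has_integral (w $ i)) {0..1})}"

text \<open>
  The Riemann constant is the point \<open>K\<close>, unique modulo the lattice \<open>\<int>\<^sup>g + \<tau>\<int>\<^sup>g\<close>, given by Riemann's
  vanishing theorem: \<open>\<theta>(z, \<tau>)\<close> vanishes iff \<open>z \<equiv> K - \<Sum>\<^sub>k \<integral>\<^sub>\<infinity>\<^bsup>P\<^sub>k\<^esup> (2\<omega>')\<^sup>-\<^sup>1\<omega>\<close> for some points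
  \<open>P\<^sub>1, \<dots>, P\<^bsub>g-1\<^esub>\<close> of the curve. Since the base point is a branch point, the set of these sums is
  symmetric and \<open>2K\<close> is a lattice point, so that the various sign conventions all agree.
\<close>

definition is_riemann_constant ::
    "nat \<Rightarrow> complex poly \<Rightarrow> complex mat \<Rightarrow> complex mat \<Rightarrow> complex vec \<Rightarrow> bool" where
  "is_riemann_constant g M \<omega>' \<tau> K \<longleftrightarrow> K \<in> carrier_vec g \<and>
     (\<forall>z\<in>carrier_vec g. theta_char g (0\<^sub>v g) (0\<^sub>v g) z \<tau> = 0 \<longleftrightarrow>
        (\<exists>w :: nat \<Rightarrow> complex vec. \<exists>m \<in> carrier_vec g. \<exists>n \<in> carrier_vec g.
           (\<forall>k<g - 1. w k \<in> abel_values g M) \<and>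
           z = K - vec g (\<lambda>i. \<Sum>k<g - 1. (minv (2 \<cdot>\<^sub>m \<omega>') *\<^sub>v w k) $ i)
                 + \<tau> *\<^sub>v cvec_of_int m + cvec_of_int n))"


section \<open>The sigma function\<close>

definition hyperelliptic_sigma ::
    "nat \<Rightarrow> complex \<Rightarrow> real vec \<Rightarrow> real vec \<Rightarrow> complex mat \<Rightarrow> complex mat \<Rightarrow> complex mat \<Rightarrow>
     complex vec \<Rightarrow> complex" where
  "hyperelliptic_sigma g \<epsilon> \<delta>' \<delta>'' \<omega>' \<eta>' \<tau> u =
     \<epsilon> * exp (1 / 2 * (u \<bullet> ((\<eta>' * minv \<omega>') *\<^sub>v u))) *
     theta_char g \<delta>' \<delta>'' (minv (2 \<cdot>\<^sub>m \<omega>') *\<^sub>v u) \<tau>"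

definition schur_p :: "(nat \<Rightarrow> complex) \<Rightarrow> int \<Rightarrow> complex" where
  "schur_p T n = (if n < 0 then 0
     else fps_nth (fps_compose (fps_exp 1) (Abs_fps (\<lambda>j. if j = 0 then 0 else T j))) (nat n))"

text \<open>
  Vectors \<open>u = (u\<^sub>1, u\<^sub>3, \<dots>, u\<^bsub>2g-1\<^esub>)\<close> are indexed by \<open>0, \<dots>, g - 1\<close>, so \<open>u\<^bsub>2i+1\<^esub>\<close> is \<open>u $ i\<close>. The
  determinant does not depend on the \<open>T\<^sub>j\<close> with \<open>j\<close> even, which are set to \<open>0\<close>.
\<close>

definition schur_S :: "nat \<Rightarrow> complex vec \<Rightarrow> complex" where
  "schur_S g u =
     (let T = (\<lambda>j. if odd j \<and> j < 2 * g then u $ (j div 2) else 0) in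
      det (mat g g (\<lambda>(i, j). schur_p T (int g + int (Suc j) + 1 - 2 * int (Suc i)))))"

text \<open>\<open>S(u)\<close> is the lowest part of the Taylor expansion at \<open>0\<close> for the weights \<open>deg u\<^bsub>2i-1\<^esub> = 2i - 1\<close>.\<close>

definition sigma_normalized :: "nat \<Rightarrow> (complex vec \<Rightarrow> complex) \<Rightarrow> bool" where
  "sigma_normalized g \<sigma> \<longleftrightarrow>
     (\<exists>(\<gamma> :: (nat \<Rightarrow> nat) \<Rightarrow> complex) r. r > 0 \<and>
       (\<forall>u\<in>carrier_vec g. (\<forall>i<g. cmod (u $ i) < r) \<longrightarrow>
          ((\<lambda>n. \<gamma> n * (\<Prod>i<g. (u $ i) ^ n i)) has_sum (\<sigma> u - schur_S g u))
            {n \<in> {..<g} \<rightarrow>\<^sub>E UNIV. (\<Sum>i<g. (2 * i + 1) * n i) > g * (g + 1) div 2}))"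


section \<open>The transformation between the two curves\<close>

definition zeta :: "nat \<Rightarrow> complex \<Rightarrow> complex \<Rightarrow> complex \<Rightarrow> complex \<times> complex \<Rightarrow> complex \<times> complex" where
  "zeta g s t a = (\<lambda>(x, y). (s / (x - a), t * y / (x - a) ^ (g + 1)))"

definition zeta_pullback :: "nat \<Rightarrow> complex \<Rightarrow> complex \<Rightarrow> complex \<Rightarrow> form \<Rightarrow> form" where
  "zeta_pullback g s t a h =
     (\<lambda>(x, y). h (zeta g s t a (x, y)) * deriv (\<lambda>x. s / (x - a)) x)"

definition f_even :: "nat \<Rightarrow> (nat \<Rightarrow> complex) \<Rightarrow> complex \<Rightarrow> complex \<Rightarrow> complex" where
  "f_even g \<nu> e1 e2 = (\<Sum>i = 0..g + 1. e1 ^ i * e2 ^ i *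
     (2 * \<nu> (4 * g + 4 - 4 * i) + (if i = g + 1 then 0 else \<nu> (4 * g + 2 - 4 * i)) * (e1 + e2)))"

definition f_odd :: "nat \<Rightarrow> (nat \<Rightarrow> complex) \<Rightarrow> complex \<Rightarrow> complex \<Rightarrow> complex" where
  "f_odd g l e1 e2 = (\<Sum>i = 0..g. e1 ^ i * e2 ^ i *
     (2 * l (4 * g + 2 - 4 * i) + l (4 * g - 4 * i) * (e1 + e2)))"

text \<open>
  This is a polynomial in \<open>e1, e2\<close>; because of the division by zero the formula represents it only
  for \<open>e1 \<noteq> a\<close> and \<open>e2 \<noteq> a\<close>.
\<close>

definition f_bar ::
    "nat \<Rightarrow> (nat \<Rightarrow> complex) \<Rightarrow> complex \<Rightarrow> complex \<Rightarrow> complex \<Rightarrow> complex \<Rightarrow> complex \<Rightarrow> complex" where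
  "f_bar g l s t a e1 e2 =
     (e1 - a) ^ (g + 1) * (e2 - a) ^ (g + 1) / t ^ 2 * f_odd g l (s / (e1 - a)) (s / (e2 - a))"

text \<open>In both cases the exponent of \<open>s\<close> is an integer.\<close>

definition chi :: "nat \<Rightarrow> complex \<Rightarrow> complex \<Rightarrow> complex" where
  "chi g s t =
     (if odd (g * (g + 1) div 2) then s powi (((int g) ^ 2 - 3 * int g - 2) div 4) * t
      else s ^ (g * (g + 1) div 4))"

definition kappa ::
    "nat \<Rightarrow> (nat \<Rightarrow> complex) \<Rightarrow> complex \<Rightarrow> complex \<Rightarrow> complex \<Rightarrow> complex mat \<Rightarrow> complex mat \<Rightarrow>
     nat \<Rightarrow> form" where
  "kappa g l s t a D \<Omega> i = (\<lambda>p.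
     (\<Sum>k = 1..g. zeta_pullback g s t a (eta g l k) p * D $$ (k - 1, i - 1))
     - 2 * (\<Sum>j = 1..g. \<Omega> $$ (i - 1, j - 1) * mu j p))"

end

theory Submission
  imports Defs "HOL-Complex_Analysis.Cauchy_Integral_Theorem"
begin

text \<open>
  Both sides are an exponential of a quadratic form in \<open>v\<close> times a theta value, and the two
  descriptions are related by how the period matrices transform under \<open>\<zeta>\<close>. Integrating
  \<open>\<zeta>\<^sup>*\<omega> = D\<mu>\<close> over the \<open>\<aa>\<close>-cycles gives \<open>\<omega>' = D\<mu>'\<close>, so that \<open>(2\<omega>')\<^sup>-\<^sup>1D = (2\<mu>')\<^sup>-\<^sup>1\<close> and the theta
  arguments agree. Integrating the definition of the \<open>\<kappa>\<^sub>i\<close> gives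
  \<open>\<kappa>' = \<^sup>tD\<eta>' + 2\<Omega>\<mu>'\<close>, hence \<open>\<kappa>'\<mu>'\<^sup>-\<^sup>1 = \<^sup>tD \<eta>'\<omega>'\<^sup>-\<^sup>1 D + 2\<Omega>\<close>: the first term is the
  quadratic form of \<open>\<sigma>(Dv)\<close>, and the second one accounts for the factor \<open>exp(\<^sup>tv\<Omega>v)\<close> of \<open>H\<close>.

  Two points need more than matrix algebra. Linearity of the integral requires the forms to be
  integrable along piecewise \<open>C\<^sup>1\<close> loops, whose velocity may be unbounded near a
  break point; \<open>form_integrable_holomorphic_over_y\<close> obtains this from local
  primitives. And the cancellation \<open>\<mu>'\<mu>'\<^sup>-\<^sup>1 = 1\<close> requires \<open>\<mu>'\<close> to be nonsingular, which is
  classically a consequence of Riemann's bilinear relations. Here the singular case is settled by the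
  normalisation of \<open>\<sigma>\<close> instead: the totalised inverses are then zero, so only the theta value
  at the origin enters either side, and it vanishes because \<open>\<sigma>(0) = 0\<close>
  (\<open>sigma_normalized_imp_zero_at_origin\<close>) while \<open>\<epsilon> \<noteq> 0\<close>.
\<close>

hide_type (open) Finite_Cartesian_Product.vec
hide_const (open) Finite_Cartesian_Product.vec Finite_Cartesian_Product.mat
  Determinants.det Finite_Cartesian_Product.row Finite_Cartesian_Product.column
unbundle no vec_syntax
unbundle no inner_syntax

section \<open>Matrices and their totalised inverse\<close>

lemma minv_carrier [simp]:
  assumes A: "A \<in> carrier_mat n n"
  shows "minv A \<in> carrier_mat n n"
  using mat_inverse(2)[OF A] A by (auto simp: minv_def split: option.split)

lemma minv_nonsingular:
  assumes A: "A \<in> carrier_mat n n" and "det A \<noteq> 0"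
  shows "A * minv A = 1\<^sub>m n" "minv A * A = 1\<^sub>m n"
proof -
  have "A \<in> Units (ring_mat TYPE(complex) n undefined)"
    using det_non_zero_imp_unit[OF assms] .
  then obtain B where "mat_inverse A = Some B"
    using mat_inverse(1)[OF A, of undefined] by (cases "mat_inverse A") auto
  then show "A * minv A = 1\<^sub>m n" "minv A * A = 1\<^sub>m n"
    using mat_inverse(2)[OF A] by (auto simp: minv_def)
qed

lemma minv_singular:
  assumes A: "A \<in> carrier_mat n n" and 0: "det A = 0"
  shows "minv A = 0\<^sub>m n n"
proof (cases "mat_inverse A")
  case None
  then show ?thesis using A by (simp add: minv_def)
next
  case (Some B)
  then have B: "A * B = 1\<^sub>m n" "B \<in> carrier_mat n n" using mat_inverse(2)[OF A] by auto
  have "det A * det B = 1" using det_mult[OF A B(2)] B(1) by simp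
  with 0 show ?thesis by simp
qed

lemma det_nonzero_if_invertible:
  assumes D: "D \<in> carrier_mat n n" and "invertible_mat D"
  shows "det (D :: complex mat) \<noteq> 0"
proof -
  obtain B where "inverts_mat D B" "inverts_mat B D"
    using assms(2) by (auto simp: invertible_mat_def)
  then have DB: "D * B = 1\<^sub>m n" and BD: "B * D = 1\<^sub>m (dim_row B)"
    using D by (auto simp: inverts_mat_def)
  have "dim_col B = n" using arg_cong[OF DB, of dim_col] by simp
  moreover have "dim_row B = n" using arg_cong[OF BD, of dim_col] D by simp
  ultimately have B: "B \<in> carrier_mat n n" by auto
  have "det D * det B = 1" using det_mult[OF D B] DB by simp
  then show ?thesis by auto
qed

text \<open>
  The identity \<open>(DA)\<^sup>-\<^sup>1D = A\<^sup>-\<^sup>1\<close> survives totalisation because \<open>D\<close> is nonsingular: \<open>DA\<close> and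
  \<open>A\<close> are singular simultaneously, and then both inverses are zero.
\<close>

lemma minv_mult_left:
  assumes D: "D \<in> carrier_mat n n" and D0: "det D \<noteq> 0" and A: "A \<in> carrier_mat n n"
  shows "minv (D * A) * D = minv A"
proof (cases "det A = 0")
  case True
  then have "det (D * A) = 0" using det_mult[OF D A] by simp
  then show ?thesis using minv_singular[of "D * A" n] minv_singular[OF A True] D A by simp
next
  case False
  then have "det (D * A) \<noteq> 0" using det_mult[OF D A] D0 by simp
  then have "minv (D * A) * (D * A) = 1\<^sub>m n"
    by (intro minv_nonsingular(2) mult_carrier_mat[OF D A])
  moreover have Mc: "minv (D * A) \<in> carrier_mat n n"
    by (rule minv_carrier[OF mult_carrier_mat[OF D A]])
  ultimately have *: "minv (D * A) * D * A = 1\<^sub>m n"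
    using D A assoc_mult_mat[of "minv (D * A)" n n D n A n] by simp
  have "minv (D * A) * D = minv (D * A) * D * (A * minv A)"
    using minv_nonsingular[OF A False] D A Mc by simp
  also have "\<dots> = minv (D * A) * D * A * minv A"
    using assoc_mult_mat[OF mult_carrier_mat[OF Mc D] A minv_carrier[OF A]] by simp
  also have "\<dots> = minv A"
    unfolding * by (rule left_mult_one_mat[OF minv_carrier[OF A]])
  finally show ?thesis .
qed

lemma quadratic_form_substitution:
  fixes D :: "complex mat"
  assumes "D \<in> carrier_mat n n" "X \<in> carrier_mat n n" "v \<in> carrier_vec n"
  shows "(D *\<^sub>v v) \<bullet> (X *\<^sub>v (D *\<^sub>v v)) = v \<bullet> ((transpose_mat D * X * D) *\<^sub>v v)"
proof -
  let ?y = "X *\<^sub>v (D *\<^sub>v v)"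
  have y: "?y \<in> carrier_vec n" using assms by simp
  have "(D *\<^sub>v v) \<bullet> ?y = ?y \<bullet> (D *\<^sub>v v)"
    using assms y by (intro comm_scalar_prod[of _ n]) auto
  also have "\<dots> = (transpose_mat D *\<^sub>v ?y) \<bullet> v"
    using transpose_vec_mult_scalar[OF assms(1,3) y] by simp
  also have "\<dots> = v \<bullet> (transpose_mat D *\<^sub>v ?y)"
    using assms y by (intro comm_scalar_prod[of _ n]) auto
  also have "transpose_mat D *\<^sub>v ?y = (transpose_mat D * X * D) *\<^sub>v v"
    using assms by (simp add: assoc_mult_mat_vec[of _ n n _ n])
  finally show ?thesis .
qed

section \<open>Integrating forms along loops on the curve\<close>

lemma regular_loop_on_curve:
  assumes "regular_loop N \<gamma>" "t \<in> {0..1}"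
  shows "\<gamma> t \<in> affine_curve N" "snd (\<gamma> t) ^ 2 = poly N (fst (\<gamma> t))" "snd (\<gamma> t) \<noteq> 0"
proof -
  have "path_image \<gamma> \<subseteq> {(x, y) \<in> affine_curve N. y \<noteq> 0}"
    using assms(1) by (simp only: regular_loop_def)
  moreover have "\<gamma> t \<in> path_image \<gamma>" using assms(2) by (simp add: path_image_def)
  ultimately have "\<gamma> t \<in> {(x, y) \<in> affine_curve N. y \<noteq> 0}" by (rule subsetD)
  then show "\<gamma> t \<in> affine_curve N" "snd (\<gamma> t) ^ 2 = poly N (fst (\<gamma> t))" "snd (\<gamma> t) \<noteq> 0"
    by (simp_all add: affine_curve_def case_prod_beta)
qed

definition form_integrable :: "form \<Rightarrow> (real \<Rightarrow> complex \<times> complex) \<Rightarrow> bool" where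
  "form_integrable h \<gamma> \<longleftrightarrow>
     (\<lambda>t. h (\<gamma> t) * vector_derivative (\<lambda>t. fst (\<gamma> t)) (at t within {0..1})) integrable_on {0..1}"

lemma form_integral_cong:
  assumes "\<And>t. t \<in> {0..1} \<Longrightarrow> h (\<gamma> t) = h' (\<gamma> t)"
  shows "form_integral h \<gamma> = form_integral h' \<gamma>"
  unfolding form_integral_def using assms by (intro integral_cong) simp

lemma form_integrable_cong:
  assumes "\<And>t. t \<in> {0..1} \<Longrightarrow> h (\<gamma> t) = h' (\<gamma> t)"
  shows "form_integrable h \<gamma> \<longleftrightarrow> form_integrable h' \<gamma>"
  unfolding form_integrable_def using assms by (intro integrable_cong) simp

text \<open>
  Linearity over a finite family rests on the integrability of every member: a nonintegrable integrand
  has integral \<open>0\<close> by convention.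
\<close>

lemma form_integral_sum:
  assumes "finite K" "\<And>k. k \<in> K \<Longrightarrow> form_integrable (h k) \<gamma>"
  shows "form_integral (\<lambda>p. \<Sum>k\<in>K. c k * h k p) \<gamma> = (\<Sum>k\<in>K. c k * form_integral (h k) \<gamma>)"
    and "form_integrable (\<lambda>p. \<Sum>k\<in>K. c k * h k p) \<gamma>"
proof -
  let ?d = "\<lambda>t. vector_derivative (\<lambda>t. fst (\<gamma> t)) (at t within {0..1})"
  have eq: "(\<Sum>k\<in>K. c k * h k (\<gamma> t)) * ?d t = (\<Sum>k\<in>K. c k * (h k (\<gamma> t) * ?d t))" for t
    by (simp add: sum_distrib_right mult.assoc)
  have int: "(\<lambda>t. c k * (h k (\<gamma> t) * ?d t)) integrable_on {0..1}" if "k \<in> K" for k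
    using assms(2)[OF that] unfolding form_integrable_def by (rule integrable_on_mult_right)
  show "form_integral (\<lambda>p. \<Sum>k\<in>K. c k * h k p) \<gamma> = (\<Sum>k\<in>K. c k * form_integral (h k) \<gamma>)"
    unfolding form_integral_def eq using assms(1) int
    by (simp add: integral_sum)
  show "form_integrable (\<lambda>p. \<Sum>k\<in>K. c k * h k p) \<gamma>"
    unfolding form_integrable_def eq using assms(1) int by (intro integrable_sum) auto
qed

lemma form_integral_add:
  assumes "form_integrable h \<gamma>" "form_integrable h' \<gamma>"
  shows "form_integral (\<lambda>p. h p + h' p) \<gamma> = form_integral h \<gamma> + form_integral h' \<gamma>"
  using assms unfolding form_integral_def form_integrable_def distrib_right
  by (rule integral_add)

text \<open>
  Continuity of the form along the path is not sufficient, as the derivative of a piecewise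
  \<open>C\<^sup>1\<close> path may be unbounded near a break point. But where \<open>y \<noteq> 0\<close> the equation
  \<open>y\<^sup>2 = N(x)\<close> makes \<open>y\<close> a holomorphic function of \<open>x\<close>, so that \<open>R(x)/y dx\<close> is locally
  \<open>dF(x)\<close> for a holomorphic \<open>F\<close>. The fundamental theorem of calculus with finitely many
  exceptional points then gives integrability on small intervals, and compactness on \<open>[0, 1]\<close>.
\<close>

lemma form_integrable_holomorphic_over_y:
  assumes loop: "regular_loop N \<gamma>" and U: "open U" and R: "R holomorphic_on U"
    and sub: "fst ` path_image \<gamma> \<subseteq> U"
  shows "form_integrable (\<lambda>(x, y). R x / y) \<gamma>"
proof -
  define X where "X = (\<lambda>t. fst (\<gamma> t))"
  define Y where "Y = (\<lambda>t. snd (\<gamma> t))"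
  obtain S where S: "finite S" "\<gamma> C1_differentiable_on ({0..1} - S)" and cont: "continuous_on {0..1} \<gamma>"
    using loop by (auto simp: regular_loop_def valid_path_def piecewise_C1_differentiable_on_def)
  have contX: "continuous_on {0..1} X" and contY: "continuous_on {0..1} Y"
    unfolding X_def Y_def using cont by (auto intro!: continuous_intros)
  have curve: "Y t ^ 2 = poly N (X t)" "Y t \<noteq> 0" "X t \<in> U" if "t \<in> {0..1}" for t
  proof -
    have "\<gamma> t \<in> path_image \<gamma>" using that by (simp add: path_image_def)
    then show "X t \<in> U" using subsetD[OF sub imageI] by (simp add: X_def)
    show "Y t ^ 2 = poly N (X t)" "Y t \<noteq> 0"
      using regular_loop_on_curve[OF loop that] by (simp_all add: X_def Y_def)
  qed
  have "(\<lambda>t. R (X t) / Y t * vector_derivative X (at t within {0..1})) integrable_on cbox 0 1"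
  proof (rule integrable_on_little_subintervals, rule ballI)
    fix t0 :: real assume "t0 \<in> cbox 0 1"
    then have t0: "t0 \<in> {0..1}" by simp
    define y0 where "y0 = Y t0"
    define W where "W = U \<inter> (\<lambda>x. poly N x / y0\<^sup>2) -` (- \<real>\<^sub>\<le>\<^sub>0)"
    have y0: "y0 \<noteq> 0" using curve(2)[OF t0] by (simp add: y0_def)
    have "open W"
      unfolding W_def using U y0
      by (intro open_Int open_vimage continuous_intros) (auto intro: closed_nonpos_Reals_complex)
    moreover have "X t0 \<in> W"
      using curve[OF t0] y0 by (auto simp: W_def y0_def simp flip: curve(1))
    ultimately obtain e where e: "e > 0" "ball (X t0) e \<subseteq> W"
      using open_contains_ball by blast
    have contR: "continuous_on {0..1} (\<lambda>t. Re (Y t / y0))"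
      using contY y0 by (auto intro!: continuous_intros)
    obtain d1 where d1: "d1 > 0" "\<And>t. t \<in> {0..1} \<Longrightarrow> dist t t0 < d1 \<Longrightarrow> dist (X t) (X t0) < e"
      using contX t0 e(1) unfolding continuous_on_iff by metis
    have "\<exists>d>0. \<forall>t\<in>{0..1}. dist t t0 < d \<longrightarrow> dist (Re (Y t / y0)) (Re (Y t0 / y0)) < 1"
      using contR[unfolded continuous_on_iff, rule_format, OF t0, of 1] by simp
    then obtain d2 where d2: "d2 > 0"
      "\<And>t. t \<in> {0..1} \<Longrightarrow> dist t t0 < d2 \<Longrightarrow> dist (Re (Y t / y0)) (Re (Y t0 / y0)) < 1"
      by blast
    have W: "x \<in> U" "poly N x / y0\<^sup>2 \<notin> \<real>\<^sub>\<le>\<^sub>0" if "x \<in> ball (X t0) e" for x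
      using e(2) that by (auto simp: W_def)
    \<comment> \<open>The branch of \<open>sqrt N\<close> near \<open>X t0\<close> with value \<open>y0\<close>. Dividing by \<open>y0\<^sup>2\<close> makes the argument
      of \<open>csqrt\<close> equal to \<open>1\<close> at \<open>X t0\<close>, off its branch cut.\<close>
    define \<phi> where "\<phi> = (\<lambda>x. y0 * csqrt (poly N x / y0\<^sup>2))"
    have "\<phi> holomorphic_on ball (X t0) e"
      unfolding \<phi>_def using W y0 by (intro holomorphic_intros) auto
    moreover have "\<phi> x \<noteq> 0" if "x \<in> ball (X t0) e" for x
      using W(2)[OF that] y0 by (auto simp: \<phi>_def)
    moreover have "R holomorphic_on ball (X t0) e"
      using R by (rule holomorphic_on_subset) (use W in auto)
    ultimately have "(\<lambda>x. R x / \<phi> x) holomorphic_on ball (X t0) e"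
      by (intro holomorphic_intros) auto
    then obtain F where F: "\<And>x. x \<in> ball (X t0) e \<Longrightarrow>
        (F has_field_derivative R x / \<phi> x) (at x within ball (X t0) e)"
      using holomorphic_convex_primitive'[OF convex_ball open_ball] by blast
    have F: "(F has_field_derivative R x / \<phi> x) (at x)" if "x \<in> ball (X t0) e" for x
      using F[OF that] that by (simp add: at_within_open[OF that])
    \<comment> \<open>Closeness of \<open>X\<close> keeps the path in the domain of \<open>F\<close>; a real part of \<open>Y / y0\<close> close to \<open>1\<close>
      keeps it on the branch \<open>\<phi>\<close> rather than \<open>-\<phi>\<close>.\<close>
    define d where "d = min d1 d2"
    have near: "X t \<in> ball (X t0) e" "\<phi> (X t) = Y t" if "t \<in> {0..1}" "dist t t0 < d" for t
    proof -
      show "X t \<in> ball (X t0) e" using d1(2)[of t] that by (simp add: d_def dist_commute)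
      have "Re (Y t0 / y0) = 1" using y0 by (simp add: y0_def)
      with d2(2)[of t] that have "Re (Y t / y0) > 0" by (auto simp: d_def dist_real_def)
      then have "csqrt ((Y t / y0)\<^sup>2) = Y t / y0" by (intro csqrt_square) auto
      then show "\<phi> (X t) = Y t"
        using y0 curve(1)[OF that(1)] by (simp add: \<phi>_def power_divide)
    qed
    have "(\<lambda>t. R (X t) / Y t * vector_derivative X (at t within {0..1})) integrable_on cbox u v"
      if uv: "t0 \<in> cbox u v" "cbox u v \<subseteq> ball t0 d" "cbox u v \<subseteq> cbox 0 1" for u v
    proof -
      have le: "u \<le> v" using uv(1) by simp
      have ok: "t \<in> {0..1}" "dist t t0 < d" if "t \<in> {u..v}" for t
        using uv that by (auto simp: dist_commute subset_iff)
      have "((\<lambda>t. R (X t) / Y t * vector_derivative X (at t within {0..1})) has_integral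
          (F \<circ> X) v - (F \<circ> X) u) {u..v}"
      proof (rule fundamental_theorem_of_calculus_interior_strong[OF S(1) le])
        have "continuous_on (ball (X t0) e) F"
          using F by (meson DERIV_isCont continuous_at_imp_continuous_on)
        then show "continuous_on {u..v} (F \<circ> X)"
          using continuous_on_subset[OF contX, of "{u..v}"] ok near(1)
          by (intro continuous_on_compose) (auto intro: continuous_on_subset)
      next
        fix t assume t: "t \<in> {u<..<v} - S"
        then have t1: "t \<in> {u..v}" by auto
        note t2 = ok[OF t1]
        have "t \<in> {0..1} - S" using t t2 by auto
        then obtain \<gamma>' where "(\<gamma> has_vector_derivative \<gamma>') (at t)"
          using S(2) unfolding C1_differentiable_on_def by meson
        then have X': "(X has_vector_derivative fst \<gamma>') (at t)"
          unfolding X_def by (rule bounded_linear.has_vector_derivative[OF bounded_linear_fst])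
        have "vector_derivative X (at t within {0..1}) = fst \<gamma>'"
          using X' t2 by (intro vector_derivative_at_within_ivl) auto
        then show "((F \<circ> X) has_vector_derivative
            R (X t) / Y t * vector_derivative X (at t within {0..1})) (at t)"
          using field_vector_diff_chain_at[OF X' F[OF near(1)[OF t2]]] near(2)[OF t2]
          by (simp add: mult.commute)
      qed
      then show ?thesis by (auto simp: integrable_on_def)
    qed
    moreover have "d > 0" using d1 d2 by (simp add: d_def)
    ultimately show "\<exists>d>0. \<forall>u v. t0 \<in> cbox u v \<and> cbox u v \<subseteq> ball t0 d \<and> cbox u v \<subseteq> cbox 0 1 \<longrightarrow>
        (\<lambda>t. R (X t) / Y t * vector_derivative X (at t within {0..1})) integrable_on cbox u v"
      by blast
  qed
  then show ?thesis
    by (simp add: form_integrable_def X_def Y_def case_prod_beta)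
qed

text \<open>
  Change of variables, applied pointwise to the integrands: they agree by the chain rule wherever
  the path is differentiable, that is, outside a finite set.
\<close>

lemma form_integral_zeta:
  assumes "valid_path \<gamma>" and a: "\<And>t. t \<in> {0..1} \<Longrightarrow> fst (\<gamma> t) \<noteq> a"
  shows "form_integral h (zeta g s c a \<circ> \<gamma>) = form_integral (zeta_pullback g s c a h) \<gamma>"
proof -
  obtain S where S: "finite S" "\<gamma> C1_differentiable_on ({0..1} - S)"
    using assms by (auto simp: valid_path_def piecewise_C1_differentiable_on_def)
  have "zeta_pullback g s c a h (\<gamma> t) * vector_derivative (\<lambda>t. fst (\<gamma> t)) (at t within {0..1}) =
     h ((zeta g s c a \<circ> \<gamma>) t) *
       vector_derivative (\<lambda>t. fst ((zeta g s c a \<circ> \<gamma>) t)) (at t within {0..1})"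
    if t: "t \<in> {0..1} - S" for t
  proof -
    let ?m = "\<lambda>x. s / (x - a)"
    obtain \<gamma>' where "(\<gamma> has_vector_derivative \<gamma>') (at t)"
      using S(2) t unfolding C1_differentiable_on_def by meson
    then have X': "((\<lambda>t. fst (\<gamma> t)) has_vector_derivative fst \<gamma>') (at t)"
      by (rule bounded_linear.has_vector_derivative[OF bounded_linear_fst])
    have "?m field_differentiable at (fst (\<gamma> t))"
      using a t by (intro derivative_intros) auto
    then have "(?m has_field_derivative deriv ?m (fst (\<gamma> t))) (at (fst (\<gamma> t)))"
      by (rule field_differentiable_derivI)
    from field_vector_diff_chain_at[OF X' this]
    have "((\<lambda>t. fst ((zeta g s c a \<circ> \<gamma>) t)) has_vector_derivative
        fst \<gamma>' * deriv ?m (fst (\<gamma> t))) (at t)"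
      by (simp add: o_def zeta_def case_prod_beta)
    then have "vector_derivative (\<lambda>t. fst ((zeta g s c a \<circ> \<gamma>) t)) (at t within {0..1}) =
        fst \<gamma>' * deriv ?m (fst (\<gamma> t))"
      using t by (intro vector_derivative_at_within_ivl) auto
    moreover have "vector_derivative (\<lambda>t. fst (\<gamma> t)) (at t within {0..1}) = fst \<gamma>'"
      using X' t by (intro vector_derivative_at_within_ivl) auto
    ultimately show ?thesis by (simp add: zeta_pullback_def case_prod_beta)
  qed
  then show ?thesis
    unfolding form_integral_def using S(1)
    by (intro integral_spike[OF negligible_finite]) auto
qed

section \<open>Period matrices\<close>

lemma half_periods_carrier [simp]: "half_periods g h c \<in> carrier_mat g g"
  by (simp add: half_periods_def)

lemma half_periods_linear_combination:
  assumes C: "C \<in> carrier_mat g g"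
    and int: "\<And>k j. k \<in> {1..g} \<Longrightarrow> j \<in> {1..g} \<Longrightarrow> form_integrable (h k) (c j)"
  shows "half_periods g (\<lambda>i p. \<Sum>k = 1..g. C $$ (i - 1, k - 1) * h k p) c = C * half_periods g h c"
proof (rule eq_matI)
  fix i j assume "i < dim_row (C * half_periods g h c)" "j < dim_col (C * half_periods g h c)"
  then have ij: "i < g" "j < g" using C by (auto simp: half_periods_def)
  have "form_integral (\<lambda>p. \<Sum>k = 1..g. C $$ (i, k - 1) * h k p) (c (Suc j)) =
      (\<Sum>k = 1..g. C $$ (i, k - 1) * form_integral (h k) (c (Suc j)))"
    using ij by (intro form_integral_sum int) auto
  also have "\<dots> = (\<Sum>k<g. C $$ (i, k) * form_integral (h (Suc k)) (c (Suc j)))"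
    by (simp add: sum.atLeast1_atMost_eq)
  finally show "half_periods g (\<lambda>i p. \<Sum>k = 1..g. C $$ (i - 1, k - 1) * h k p) c $$ (i, j) =
      (C * half_periods g h c) $$ (i, j)"
    using ij C
    by (simp add: half_periods_def scalar_prod_def sum_divide_distrib atLeast0LessThan)
qed (use C in \<open>auto simp: half_periods_def\<close>)

lemma half_periods_add:
  assumes "\<And>k j. k \<in> {1..g} \<Longrightarrow> j \<in> {1..g} \<Longrightarrow> form_integrable (h k) (c j)"
    and "\<And>k j. k \<in> {1..g} \<Longrightarrow> j \<in> {1..g} \<Longrightarrow> form_integrable (h' k) (c j)"
  shows "half_periods g (\<lambda>i p. h i p + h' i p) c = half_periods g h c + half_periods g h' c"
  unfolding half_periods_def using assms
  by (intro eq_matI) (auto simp: form_integral_add add_divide_distrib)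

lemma half_periods_cong:
  assumes "\<And>i j. i \<in> {1..g} \<Longrightarrow> j \<in> {1..g} \<Longrightarrow> form_integral (h i) (c j) = form_integral (h' i) (c' j)"
  shows "half_periods g h c = half_periods g h' c'"
  unfolding half_periods_def using assms by (intro eq_matI) auto

lemma form_integrable_mu:
  assumes "regular_loop N \<gamma>"
  shows "form_integrable (mu i) \<gamma>"
proof -
  have "form_integrable (\<lambda>(x, y). (x ^ (i - 1) / 2) / y) \<gamma>"
    by (rule form_integrable_holomorphic_over_y[OF assms open_UNIV]) (auto intro!: holomorphic_intros)
  then show ?thesis by (simp add: mu_def)
qed

text \<open>
  The pullback is brought into the form \<open>R(x)/y\<close> with \<open>R\<close> holomorphic away from \<open>a\<close>, to which
  \<open>form_integrable_holomorphic_over_y\<close> applies. The constant enters as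
  \<open>inverse (2 * c)\<close>, so that \<open>R\<close> is visibly holomorphic for every \<open>c\<close>.
\<close>

lemma zeta_pullback_eta:
  assumes "x \<noteq> a"
  shows "zeta_pullback g s c a (eta g l k) (x, y) =
    (\<Sum>i = g - k + 1..g + k - 1.
       of_nat (i + k - g) * l (2 * g + 2 * k - 2 * i - 2) * (s / (x - a)) ^ i)
     * ((x - a) ^ (g + 1) * inverse (2 * c) * (s / (x - a) ^ 2)) / y"
proof -
  have "((\<lambda>x. s / (x - a)) has_field_derivative - (s / (x - a)\<^sup>2)) (at x)"
    using assms by (auto intro!: derivative_eq_intros simp: power2_eq_square)
  then have d: "deriv (\<lambda>x. s / (x - a)) x = - (s / (x - a)\<^sup>2)"
    by (rule DERIV_imp_deriv)
  have "- (1 / (2 * (c * y / P))) * S * - q = S * (P * inverse (2 * c) * q) / y" for P S q :: complex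
    by (cases "P = 0"; cases "y = 0"; cases "c = 0"; simp add: field_simps)
  then show ?thesis
    unfolding zeta_pullback_def zeta_def eta_def prod.case d .
qed

lemma form_integrable_zeta_pullback_eta:
  assumes loop: "regular_loop N \<gamma>" and a: "\<And>t. t \<in> {0..1} \<Longrightarrow> fst (\<gamma> t) \<noteq> a"
  shows "form_integrable (zeta_pullback g s c a (eta g l k)) \<gamma>"
proof -
  let ?R = "\<lambda>x. (\<Sum>i = g - k + 1..g + k - 1.
       of_nat (i + k - g) * l (2 * g + 2 * k - 2 * i - 2) * (s / (x - a)) ^ i)
     * ((x - a) ^ (g + 1) * inverse (2 * c) * (s / (x - a) ^ 2))"
  have int: "form_integrable (\<lambda>(x, y). ?R x / y) \<gamma>"
  proof (rule form_integrable_holomorphic_over_y[OF loop])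
    show "open (- {a})" by (intro open_Compl closed_singleton)
    show "?R holomorphic_on - {a}" by (intro holomorphic_intros) auto
    show "fst ` path_image \<gamma> \<subseteq> - {a}"
      unfolding path_image_def using a by (intro subsetI) (elim imageE, simp)
  qed
  have "(case \<gamma> t of (x, y) \<Rightarrow> ?R x / y) = zeta_pullback g s c a (eta g l k) (\<gamma> t)"
    if "t \<in> {0..1}" for t
  proof -
    from zeta_pullback_eta[OF a[OF that], of g s c l k "snd (\<gamma> t)"] show ?thesis
      by (simp only: case_prod_beta prod.collapse)
  qed
  from form_integrable_cong[of "\<lambda>(x, y). ?R x / y" \<gamma>, OF this] int show ?thesis
    by (rule iffD1)
qed

section \<open>The value of sigma at the origin\<close>

lemma schur_p_zero: "n \<noteq> 0 \<Longrightarrow> schur_p (\<lambda>j. 0) n = 0"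
proof -
  assume "n \<noteq> 0"
  have "Abs_fps (\<lambda>j. if j = 0 then 0 else (0 :: complex)) = 0" by (simp add: fps_eq_iff)
  then show ?thesis using \<open>n \<noteq> 0\<close> by (simp add: schur_p_def)
qed

text \<open>
  At the origin \<open>p\<^sub>n = 0\<close> for all \<open>n \<noteq> 0\<close>, and the indices \<open>g - 1 + j\<close> with \<open>j \<ge> 1\<close> in the first row
  of the determinant are all positive.
\<close>

lemma schur_S_zero:
  assumes "g \<ge> 1"
  shows "schur_S g (0\<^sub>v g) = 0"
proof -
  let ?T = "\<lambda>j. if odd j \<and> j < 2 * g then 0\<^sub>v g $ (j div 2) else (0 :: complex)"
  let ?P = "mat g g (\<lambda>(i, j). schur_p ?T (int g + int (Suc j) + 1 - 2 * int (Suc i)))"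
  have T: "?T = (\<lambda>j. 0)" by (auto simp: fun_eq_iff)
  have "det ?P = (\<Sum>j<g. ?P $$ (0, j) * cofactor ?P 0 j)"
    using assms by (intro laplace_expansion_row[of _ g]) auto
  also have "\<dots> = 0"
    using assms by (intro sum.neutral) (auto simp: T schur_p_zero)
  finally show ?thesis by (simp add: schur_S_def Let_def)
qed

text \<open>
  The constant monomial has weight \<open>0\<close>, hence it occurs neither in \<open>S\<close> nor among the terms of
  higher weight.
\<close>

lemma sigma_normalized_imp_zero_at_origin:
  assumes g: "g \<ge> 1" and "sigma_normalized g \<sigma>"
  shows "\<sigma> (0\<^sub>v g) = 0"
proof -
  obtain \<gamma> :: "(nat \<Rightarrow> nat) \<Rightarrow> complex" and r where r: "r > 0" and
    *: "\<And>u. u \<in> carrier_vec g \<Longrightarrow> (\<forall>i<g. cmod (u $ i) < r) \<Longrightarrow>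
          ((\<lambda>n. \<gamma> n * (\<Prod>i<g. (u $ i) ^ n i)) has_sum (\<sigma> u - schur_S g u))
            {n \<in> {..<g} \<rightarrow>\<^sub>E UNIV. (\<Sum>i<g. (2 * i + 1) * n i) > g * (g + 1) div 2}"
    using assms(2) unfolding sigma_normalized_def by blast
  let ?I = "{n \<in> {..<g} \<rightarrow>\<^sub>E (UNIV :: nat set). (\<Sum>i<g. (2 * i + 1) * n i) > g * (g + 1) div 2}"
  have "\<gamma> n * (\<Prod>i<g. (0\<^sub>v g $ i) ^ n i) = 0" if "n \<in> ?I" for n
  proof -
    have "(\<Sum>i<g. (2 * i + 1) * n i) \<noteq> 0" using that by auto
    then obtain i where i: "i < g" "n i \<noteq> 0" by (auto simp: sum_eq_0_iff)
    have "(\<Prod>i<g. (0\<^sub>v g $ i :: complex) ^ n i) = 0"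
      using i by (intro prod_zero) (auto intro!: bexI[of _ i])
    then show ?thesis by simp
  qed
  then have "((\<lambda>n. \<gamma> n * (\<Prod>i<g. (0\<^sub>v g $ i) ^ n i)) has_sum 0) ?I"
    by (rule has_sum_0)
  from has_sum_unique[OF this *[of "0\<^sub>v g"]] r schur_S_zero[OF g]
  show ?thesis by simp
qed

section \<open>The theta expression of \<open>H\<close>\<close>

theorem proposition4p16:
  fixes g :: nat
    and \<nu> l :: "nat \<Rightarrow> complex"
    and N M :: "complex poly"
    and a s t \<epsilon> :: complex
    and r :: "nat \<Rightarrow> complex"
    and \<aa> \<bb> A B :: "nat \<Rightarrow> real \<Rightarrow> complex \<times> complex"
    and D \<Omega> \<mu>' \<omega>' \<omega>'' \<eta>' \<tau> \<kappa>' :: "complex mat"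
    and \<delta>' \<delta>'' :: "real vec"
    and \<sigma> H :: "complex vec \<Rightarrow> complex"
  assumes g: "g \<ge> 1"
    and N: "N = (\<Sum>k = 0..2 * g + 2. Polynomial.monom (\<nu> (2 * k)) (2 * g + 2 - k))"
    and N_lead: "\<nu> 0 \<noteq> 0"
    and N_roots: "rsquarefree N"
    and a: "poly N a = 0"
    and N_factors: "N = Polynomial.smult (\<nu> 0) ([:- a, 1:] * (\<Prod>i = 1..2 * g + 1. [:- r i, 1:]))"
    and basis: "canonical_homology_basis g N \<aa> \<bb>"
    and \<mu>': "\<mu>' = half_periods g mu \<aa>"
    and st: "s * t \<noteq> 0" "s ^ (2 * g + 1) / t ^ 2 = poly (pderiv N) a"
    and M: "M = (\<Prod>i = 1..2 * g + 1. [:- (s / (r i - a)), 1:])"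
    and l: "M = (\<Sum>k = 0..2 * g + 1. Polynomial.monom (l (2 * k)) (2 * g + 1 - k))"
    and D: "D \<in> carrier_mat g g" "invertible_mat D"
      "\<And>i x y. \<lbrakk>i \<in> {1..g}; (x, y) \<in> affine_curve N; y \<noteq> 0\<rbrakk> \<Longrightarrow>
         zeta_pullback g s t a (omega g i) (x, y) = (\<Sum>j = 1..g. D $$ (i - 1, j - 1) * mu j (x, y))"
    and A: "A = (\<lambda>i. zeta g s t a \<circ> \<aa> i)"
    and B: "B = (\<lambda>i. zeta g s t a \<circ> \<bb> i)"
    and \<omega>': "\<omega>' = half_periods g (omega g) A"
    and \<omega>'': "\<omega>'' = half_periods g (omega g) B"
    and \<eta>': "\<eta>' = - half_periods g (eta g l) A"
    and \<tau>: "\<tau> = minv \<omega>' * \<omega>''"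
    and \<delta>: "\<delta>' \<in> carrier_vec g" "\<delta>'' \<in> carrier_vec g"
      "is_riemann_constant g M \<omega>' \<tau> (\<tau> *\<^sub>v cvec_of_real \<delta>' + cvec_of_real \<delta>'')"
    and \<sigma>: "\<sigma> = hyperelliptic_sigma g \<epsilon> \<delta>' \<delta>'' \<omega>' \<eta>' \<tau>"
    and \<epsilon>: "\<epsilon> \<noteq> 0" "sigma_normalized g \<sigma>"
    and \<Omega>: "\<Omega> \<in> carrier_mat g g" "transpose_mat \<Omega> = \<Omega>"
      "\<And>e1 e2. \<lbrakk>e1 \<noteq> a; e2 \<noteq> a\<rbrakk> \<Longrightarrow> f_bar g l s t a e1 e2 = f_even g \<nu> e1 e2
         + (e1 - e2) ^ 2 * (\<Sum>i = 1..g. \<Sum>j = 1..g. \<Omega> $$ (i - 1, j - 1) * e1 ^ (i - 1) * e2 ^ (j - 1))"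
    and H: "\<And>v. v \<in> carrier_vec g \<Longrightarrow> H v = chi g s t * exp (v \<bullet> (\<Omega> *\<^sub>v v)) * \<sigma> (D *\<^sub>v v)"
    and \<kappa>': "\<kappa>' = - half_periods g (kappa g l s t a D \<Omega>) \<aa>"
  shows "\<forall>v\<in>carrier_vec g.
    H v = chi g s t * \<epsilon> * exp (1 / 2 * (v \<bullet> ((\<kappa>' * minv \<mu>') *\<^sub>v v)))
          * theta_char g \<delta>' \<delta>'' (minv (2 \<cdot>\<^sub>m \<mu>') *\<^sub>v v) \<tau>"
proof (intro ballI)
  fix v :: "complex vec" assume v: "v \<in> carrier_vec g"
  have loop: "regular_loop N (\<aa> j)" if "j \<in> {1..g}" for j
    using basis that by (auto simp: canonical_homology_basis_def)
  have curve: "\<aa> j u \<in> affine_curve N" "snd (\<aa> j u) \<noteq> 0" "fst (\<aa> j u) \<noteq> a"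
    if "j \<in> {1..g}" "u \<in> {0..1}" for j u
    using regular_loop_on_curve[OF loop[OF that(1)] that(2)] a by auto
  have valid: "valid_path (\<aa> j)" if "j \<in> {1..g}" for j
    using loop[OF that] by (simp add: regular_loop_def)
  have int_mu: "form_integrable (mu k) (\<aa> j)" if "j \<in> {1..g}" for k j
    using form_integrable_mu[OF loop[OF that]] .
  define \<eta>\<^sub>V where "\<eta>\<^sub>V = (\<lambda>k. zeta_pullback g s t a (eta g l k))"
  have int_eta: "form_integrable (\<eta>\<^sub>V k) (\<aa> j)" if "j \<in> {1..g}" for k j
    unfolding \<eta>\<^sub>V_def
    using form_integrable_zeta_pullback_eta[OF loop[OF that] curve(3)[OF that]] by simp
  have \<mu>c: "\<mu>' \<in> carrier_mat g g" and \<eta>c: "\<eta>' \<in> carrier_mat g g"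
    by (auto simp: \<mu>' \<eta>')
  \<comment> \<open>The forms are only compared along the loops, where \<open>y \<noteq> 0\<close> and hence \<open>x \<noteq> a\<close>.\<close>
  have \<omega>_eq: "\<omega>' = D * \<mu>'"
  proof -
    have "\<omega>' = half_periods g (\<lambda>i p. \<Sum>k = 1..g. D $$ (i - 1, k - 1) * mu k p) \<aa>"
      unfolding \<omega>' A
    proof (rule half_periods_cong)
      fix i j assume ij: "i \<in> {1..g}" "j \<in> {1..g}"
      have "form_integral (omega g i) (zeta g s t a \<circ> \<aa> j) =
          form_integral (zeta_pullback g s t a (omega g i)) (\<aa> j)"
        using form_integral_zeta[OF valid] curve(3) ij by blast
      also have "\<dots> = form_integral (\<lambda>p. \<Sum>k = 1..g. D $$ (i - 1, k - 1) * mu k p) (\<aa> j)"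
      proof (rule form_integral_cong)
        fix u :: real assume "u \<in> {0..1}"
        from D(3)[OF ij(1), of "fst (\<aa> j u)" "snd (\<aa> j u)"] curve[OF ij(2) this]
        show "zeta_pullback g s t a (omega g i) (\<aa> j u) =
            (\<Sum>k = 1..g. D $$ (i - 1, k - 1) * mu k (\<aa> j u))" by simp
      qed
      finally show "form_integral (omega g i) (zeta g s t a \<circ> \<aa> j) =
          form_integral (\<lambda>p. \<Sum>k = 1..g. D $$ (i - 1, k - 1) * mu k p) (\<aa> j)" .
    qed
    also have "\<dots> = D * \<mu>'"
      unfolding \<mu>' using D(1) int_mu by (intro half_periods_linear_combination) auto
    finally show ?thesis .
  qed
  have \<kappa>_eq: "\<kappa>' = transpose_mat D * \<eta>' + 2 \<cdot>\<^sub>m (\<Omega> * \<mu>')"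
  proof -
    define P where "P = half_periods g \<eta>\<^sub>V \<aa>"
    have Pc: "P \<in> carrier_mat g g" by (simp add: P_def)
    have \<eta>P: "\<eta>' = - P"
      unfolding \<eta>' A P_def \<eta>\<^sub>V_def
      using form_integral_zeta[OF valid] curve(3)
      by (intro arg_cong[of _ _ uminus] half_periods_cong) blast
    let ?h = "\<lambda>i p. \<Sum>k = 1..g. transpose_mat D $$ (i - 1, k - 1) * \<eta>\<^sub>V k p"
    let ?h' = "\<lambda>i p. \<Sum>k = 1..g. ((- 2) \<cdot>\<^sub>m \<Omega>) $$ (i - 1, k - 1) * mu k p"
    have "half_periods g (kappa g l s t a D \<Omega>) \<aa> = half_periods g (\<lambda>i p. ?h i p + ?h' i p) \<aa>"
    proof (rule half_periods_cong)
      fix i j assume ij: "i \<in> {1..g}" "j \<in> {1..g}"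
      have "?h i p = (\<Sum>k = 1..g. \<eta>\<^sub>V k p * D $$ (k - 1, i - 1))" for p
        using ij D(1) by (intro sum.cong) auto
      moreover have "?h' i p = - 2 * (\<Sum>k = 1..g. \<Omega> $$ (i - 1, k - 1) * mu k p)" for p
        unfolding sum_distrib_left using ij \<Omega>(1) by (intro sum.cong) auto
      ultimately have "?h i p + ?h' i p = kappa g l s t a D \<Omega> i p" for p
        by (simp add: kappa_def \<eta>\<^sub>V_def)
      then show "form_integral (kappa g l s t a D \<Omega> i) (\<aa> j) =
          form_integral (\<lambda>p. ?h i p + ?h' i p) (\<aa> j)" by simp
    qed
    also have "\<dots> = half_periods g ?h \<aa> + half_periods g ?h' \<aa>"
      by (intro half_periods_add form_integral_sum int_eta int_mu) auto
    also have "half_periods g ?h \<aa> = transpose_mat D * P"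
      unfolding P_def using D(1) int_eta by (intro half_periods_linear_combination) auto
    also have "half_periods g ?h' \<aa> = (- 2) \<cdot>\<^sub>m \<Omega> * \<mu>'"
      unfolding \<mu>' using \<Omega>(1) int_mu by (intro half_periods_linear_combination) auto
    also have "\<dots> = (- 2) \<cdot>\<^sub>m (\<Omega> * \<mu>')"
      using \<Omega>(1) \<mu>c by (rule mult_smult_assoc_mat)
    finally have "\<kappa>' = - (transpose_mat D * P + (- 2) \<cdot>\<^sub>m (\<Omega> * \<mu>'))" unfolding \<kappa>' by simp
    also have "\<dots> = transpose_mat D * \<eta>' + 2 \<cdot>\<^sub>m (\<Omega> * \<mu>')"
      unfolding \<eta>P uminus_mult_right_mat using D(1) Pc \<Omega>(1) \<mu>c by (intro eq_matI) auto
    finally show ?thesis .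
  qed
  have D0: "det D \<noteq> 0" using det_nonzero_if_invertible D(1,2) .
  have \<omega>c: "\<omega>' \<in> carrier_mat g g" using \<omega>_eq D(1) \<mu>c by simp
  note i\<omega> = minv_carrier[OF \<omega>c] and Dt = transpose_carrier_mat[THEN iffD2, OF D(1)]
  have inv1: "minv \<omega>' * D = minv \<mu>'"
    unfolding \<omega>_eq using minv_mult_left[OF D(1) D0 \<mu>c] .
  have "minv (2 \<cdot>\<^sub>m \<omega>') * D = minv (2 \<cdot>\<^sub>m \<mu>')"
    using minv_mult_left[OF D(1) D0, of "2 \<cdot>\<^sub>m \<mu>'"] \<mu>c mult_smult_distrib[OF D(1) \<mu>c, of 2]
    by (simp add: \<omega>_eq)
  then have arg: "minv (2 \<cdot>\<^sub>m \<omega>') *\<^sub>v (D *\<^sub>v v) = minv (2 \<cdot>\<^sub>m \<mu>') *\<^sub>v v"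
    using assoc_mult_mat_vec[of "minv (2 \<cdot>\<^sub>m \<omega>')" g g D g v] D(1) \<omega>c v by simp
  let ?\<theta> = "theta_char g \<delta>' \<delta>'' (minv (2 \<cdot>\<^sub>m \<mu>') *\<^sub>v v) \<tau>"
  have quad: "(D *\<^sub>v v) \<bullet> ((\<eta>' * minv \<omega>') *\<^sub>v (D *\<^sub>v v)) =
      v \<bullet> ((transpose_mat D * \<eta>' * minv \<mu>') *\<^sub>v v)"
  proof -
    have "transpose_mat D * (\<eta>' * minv \<omega>') * D = transpose_mat D * \<eta>' * (minv \<omega>' * D)"
      unfolding assoc_mult_mat[OF Dt \<eta>c i\<omega>, symmetric]
      by (rule assoc_mult_mat[OF mult_carrier_mat[OF Dt \<eta>c] i\<omega> D(1)])
    then show ?thesis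
      using quadratic_form_substitution[OF D(1) mult_carrier_mat[OF \<eta>c i\<omega>] v] by (simp only: inv1)
  qed
  have Hv: "H v = chi g s t * \<epsilon> *
      (exp (v \<bullet> (\<Omega> *\<^sub>v v)) * exp (1 / 2 * (v \<bullet> ((transpose_mat D * \<eta>' * minv \<mu>') *\<^sub>v v)))) * ?\<theta>"
    using H[OF v] by (simp add: \<sigma> hyperelliptic_sigma_def quad arg)
  show "H v = chi g s t * \<epsilon> * exp (1 / 2 * (v \<bullet> ((\<kappa>' * minv \<mu>') *\<^sub>v v))) * ?\<theta>"
  proof (cases "det \<mu>' = 0")
    case True
    \<comment> \<open>All theta arguments collapse to the origin, where theta vanishes because \<open>\<sigma>\<close> does.\<close>
    have "det (2 \<cdot>\<^sub>m \<mu>') = 0" using True by (simp add: det_smult)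
    then have "minv (2 \<cdot>\<^sub>m \<mu>') = 0\<^sub>m g g" using \<mu>c by (intro minv_singular) auto
    then have "minv (2 \<cdot>\<^sub>m \<mu>') *\<^sub>v v = 0\<^sub>v g" using v by (intro eq_vecI) auto
    moreover have "theta_char g \<delta>' \<delta>'' (0\<^sub>v g) \<tau> = 0"
    proof -
      have "minv (2 \<cdot>\<^sub>m \<omega>') \<in> carrier_mat g g"
        using \<omega>c by (intro minv_carrier) simp
      then have "minv (2 \<cdot>\<^sub>m \<omega>') *\<^sub>v 0\<^sub>v g = 0\<^sub>v g"
        by (intro eq_vecI) auto
      then show ?thesis
        using sigma_normalized_imp_zero_at_origin[OF g \<epsilon>(2)] \<epsilon>(1)
        by (simp add: \<sigma> hyperelliptic_sigma_def)
    qed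
    ultimately show ?thesis using Hv by simp
  next
    case False
    have i\<mu>: "minv \<mu>' \<in> carrier_mat g g" using \<mu>c by simp
    have "2 \<cdot>\<^sub>m (\<Omega> * \<mu>') * minv \<mu>' = 2 \<cdot>\<^sub>m (\<Omega> * (\<mu>' * minv \<mu>'))"
      using \<Omega>(1) \<mu>c i\<mu>
      by (simp add: mult_smult_assoc_mat[of _ g g _ g] assoc_mult_mat[of _ g g _ g _ g])
    also have "\<dots> = 2 \<cdot>\<^sub>m \<Omega>" using minv_nonsingular[OF \<mu>c False] \<Omega>(1) by simp
    finally have \<Omega>i: "2 \<cdot>\<^sub>m (\<Omega> * \<mu>') * minv \<mu>' = 2 \<cdot>\<^sub>m \<Omega>" .
    let ?X = "transpose_mat D * \<eta>'"
    have Xc: "?X \<in> carrier_mat g g" by (rule mult_carrier_mat[OF Dt \<eta>c])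
    have Xi: "?X * minv \<mu>' \<in> carrier_mat g g" by (rule mult_carrier_mat[OF Xc i\<mu>])
    have "\<kappa>' * minv \<mu>' = ?X * minv \<mu>' + 2 \<cdot>\<^sub>m \<Omega>"
      by (simp only: \<kappa>_eq \<Omega>i
          add_mult_distrib_mat[OF Xc smult_carrier_mat[OF mult_carrier_mat[OF \<Omega>(1) \<mu>c]] i\<mu>])
    moreover have "(2 \<cdot>\<^sub>m \<Omega>) *\<^sub>v v = 2 \<cdot>\<^sub>v (\<Omega> *\<^sub>v v)"
      using \<Omega>(1) v by (intro eq_vecI) auto
    ultimately have "(\<kappa>' * minv \<mu>') *\<^sub>v v = (?X * minv \<mu>') *\<^sub>v v + 2 \<cdot>\<^sub>v (\<Omega> *\<^sub>v v)"
      using add_mult_distrib_mat_vec[OF Xi smult_carrier_mat[OF \<Omega>(1)] v] by simp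
    then have "v \<bullet> ((\<kappa>' * minv \<mu>') *\<^sub>v v) =
        v \<bullet> ((?X * minv \<mu>') *\<^sub>v v) + v \<bullet> (2 \<cdot>\<^sub>v (\<Omega> *\<^sub>v v))"
      using scalar_prod_add_distrib[OF v mult_mat_vec_carrier[OF Xi v]
          smult_carrier_vec[THEN iffD2, OF mult_mat_vec_carrier[OF \<Omega>(1) v]]] by simp
    also have "v \<bullet> (2 \<cdot>\<^sub>v (\<Omega> *\<^sub>v v)) = 2 * (v \<bullet> (\<Omega> *\<^sub>v v))"
      using \<Omega>(1) v by simp
    finally have "exp (1 / 2 * (v \<bullet> ((\<kappa>' * minv \<mu>') *\<^sub>v v))) =
        exp (v \<bullet> (\<Omega> *\<^sub>v v)) * exp (1 / 2 * (v \<bullet> ((?X * minv \<mu>') *\<^sub>v v)))"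
      by (simp add: distrib_left exp_add)
    then show ?thesis using Hv by (simp only:)
  qed
qed

end
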